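(* Let $\varepsilon>0$. For a dataset $D=[x,y]$ of $n$ records $(x_i,y_i)\in[0,1]^2$, let $Z_{0,0},Z_{0,1},Z_{1,0},Z_{1,1}$ be independent $\mathrm{Lap}(1/\varepsilon)$ random variables and set $$\tilde b_{1,1}=\sum_{i=1}^n x_iy_i+Z_{1,1},\quad \tilde b_{1,0}=\sum_{i=1}^n x_i(1-y_i)+Z_{1,0},$$ $$\tilde b_{0,1}=\sum_{i=1}^n (1-x_i)y_i+Z_{0,1},\quad \tilde b_{0,0}=\sum_{i=1}^n (1-x_i)(1-y_i)+Z_{0,0},$$ $\tilde n=\tilde b_{0,0}+\tilde b_{0,1}+\tilde b_{1,0}+\tilde b_{1,1}$, $\tilde s_x=\tilde b_{1,0}+\tilde b_{1,1}$, $\tilde s_y=\tilde b_{0,1}+\tilde b_{1,1}$, $\tilde s_{xy}=\tilde b_{1,1}$, and $$\hat c(D)=\mathrm{clip}\!\left(\frac{\tilde s_{xy}}{\tilde n}-\frac{\tilde s_x}{\tilde n}\cdot\frac{\tilde s_y}{\tilde n},\ [-1/4,1/4]\right).$$ Then $$R(\hat c,\mathrm{Cov},n_0)\le\frac{2}{\varepsilon^2}(1+o(1)),$$ where $o(1)\to0$ as $n_0\to\infty$ (with $\varepsilon$ fixed).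
   Context: $\mathrm{Lap}(b)$ is the Laplace distribution with density $\frac1{2b}e^{-|t|/b}$. $\mathrm{clip}(t,[l,u])=\max\{l,\min\{u,t\}\}$. (The event $\tilde n=0$ has probability $0$; the value there is irrelevant.) $\mathrm{Cov}([x,y])=\frac1n\sum_{i=1}^n x_iy_i-\left(\frac1n\sum_{i=1}^n x_i\right)\left(\frac1n\sum_{i=1}^n y_i\right)$ for a dataset $[x,y]$ of $n\ge1$ records in $[0,1]^2$. For a randomized estimator $\hat f$ of a real-valued statistic $f$ of datasets, $R(\hat f,f,D)=|D|^2\,\mathbb E[(\hat f(D)-f(D))^2]$, where $|D|$ is the number of records and the expectation is over the randomness of $\hat f$, and $R(\hat f,f,n_0)=\sup\{R(\hat f,f,D): |D|\ge n_0\}$, the supremum being over all datasets (here with records in $[0,1]^2$) of size at least $n_0$. *)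

theory Defs
  imports "HOL-Probability.Probability"
begin

definition laplace :: "real \<Rightarrow> real measure" where
  "laplace b = density lborel (\<lambda>t. ennreal (1 / (2 * b) * exp (- \<bar>t\<bar> / b)))"

lemma prob_space_laplace:
  assumes "b > 0"
  shows "prob_space (laplace b)"
proof -
  define h where "h = (\<lambda>t. ennreal (exponential_density (1 / b) t))"
  define g where "g = (\<lambda>t. ennreal (1 / (2 * b) * exp (- \<bar>t\<bar> / b)))"
  have h [measurable]: "h \<in> borel_measurable borel" by (simp add: h_def)
  have g [measurable]: "g \<in> borel_measurable borel" by (simp add: g_def)
  interpret E: prob_space "density lborel h"
    unfolding h_def using assms by (intro prob_space_exponential_density) simp
  have "(\<integral>\<^sup>+t. h t \<partial>lborel) = 1"
    using E.emeasure_space_1 by (simp add: emeasure_density)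
  moreover have "(\<integral>\<^sup>+t. h (- t) \<partial>lborel) = (\<integral>\<^sup>+t. h t \<partial>lborel)"
    using nn_integral_real_affine[of h "-1" 0] by simp
  ultimately have "(\<integral>\<^sup>+t. h t + h (- t) \<partial>lborel) = 2"
    by (subst nn_integral_add) auto
  moreover have "AE t in lborel. h t + h (- t) = 2 * g t"
    using AE_lborel_singleton[of 0]
  proof eventually_elim
    case (elim t)
    have "h t + h (- t) = ennreal (2 * (1 / (2 * b) * exp (- \<bar>t\<bar> / b)))"
      using elim assms by (auto simp: h_def exponential_density_def abs_if)
    also have "\<dots> = 2 * g t"
      unfolding g_def using assms by (subst ennreal_mult) auto
    finally show ?case .
  qed
  then have "(\<integral>\<^sup>+t. h t + h (- t) \<partial>lborel) = 2 * (\<integral>\<^sup>+t. g t \<partial>lborel)"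
    by (subst nn_integral_cong_AE) (auto simp: nn_integral_cmult)
  ultimately have "2 * (\<integral>\<^sup>+t. g t \<partial>lborel) = 2 * 1"
    by simp
  then have "(\<integral>\<^sup>+t. g t \<partial>lborel) = 1"
    by (subst (asm) ennreal_mult_cancel_left) auto
  then show ?thesis
    unfolding laplace_def g_def[symmetric] by (intro prob_spaceI) (simp add: emeasure_density)
qed

definition clip :: "real \<Rightarrow> real \<Rightarrow> real \<Rightarrow> real" where
  "clip l u t = max l (min u t)"

definition cov :: "(real \<times> real) list \<Rightarrow> real" where
  "cov D = (\<Sum>(x, y)\<leftarrow>D. x * y) / real (length D)
         - ((\<Sum>(x, y)\<leftarrow>D. x) / real (length D)) * ((\<Sum>(x, y)\<leftarrow>D. y) / real (length D))"

text \<open>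
  A randomized estimator is given by the law of its output on each dataset. The risks take values
  in \<^typ>\<open>ennreal\<close>, so that the expectation and the supremum are total and possibly infinite.
\<close>

definition risk ::
    "('a list \<Rightarrow> real measure) \<Rightarrow> ('a list \<Rightarrow> real) \<Rightarrow> 'a list \<Rightarrow> ennreal" where
  "risk fhat f D = (of_nat (length D))\<^sup>2 * (\<integral>\<^sup>+ t. ennreal ((t - f D)\<^sup>2) \<partial>fhat D)"

definition worst_risk ::
    "'a set \<Rightarrow> ('a list \<Rightarrow> real measure) \<Rightarrow> ('a list \<Rightarrow> real) \<Rightarrow> nat \<Rightarrow> ennreal" where
  "worst_risk X fhat f n0 = (SUP D \<in> {D \<in> lists X. n0 \<le> length D}. risk fhat f D)"

definition cov_post :: "(real \<times> real) list \<Rightarrow> (nat \<times> nat \<Rightarrow> real) \<Rightarrow> real" where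
  "cov_post D Z =
    (let b11 = (\<Sum>(x, y)\<leftarrow>D. x * y) + Z (1, 1);
         b10 = (\<Sum>(x, y)\<leftarrow>D. x * (1 - y)) + Z (1, 0);
         b01 = (\<Sum>(x, y)\<leftarrow>D. (1 - x) * y) + Z (0, 1);
         b00 = (\<Sum>(x, y)\<leftarrow>D. (1 - x) * (1 - y)) + Z (0, 0);
         n = b00 + b01 + b10 + b11;
         sx = b10 + b11;
         sy = b01 + b11;
         sxy = b11
     in clip (- 1 / 4) (1 / 4) (sxy / n - (sx / n) * (sy / n)))"

lemma measurable_cov_post:
  "cov_post D \<in> borel_measurable (\<Pi>\<^sub>M ij \<in> {0, 1} \<times> {0, 1}. laplace b)"
proof -
  have *: "(\<lambda>Z. Z ij) \<in> borel_measurable (\<Pi>\<^sub>M ij \<in> {0, 1} \<times> {0, 1}. laplace b)"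
    if "ij \<in> {0, 1} \<times> {0, 1}" for ij :: "nat \<times> nat"
    using measurable_component_singleton[OF that, of "\<lambda>_. laplace b"]
    by (simp add: laplace_def cong: measurable_cong_sets)
  note [measurable] = *[of "(0, 0)", simplified] *[of "(0, 1)", simplified]
    *[of "(1, 0)", simplified] *[of "(1, 1)", simplified]
  show ?thesis
    unfolding cov_post_def clip_def Let_def by simp
qed

text \<open>
  The coordinates under the product measure are the four independent noise variables. The total
  division of HOL fixes the value on the null event that the noisy count is zero.
\<close>

definition cov_est :: "real \<Rightarrow> (real \<times> real) list \<Rightarrow> real measure" where
  "cov_est \<epsilon> D =
    distr (\<Pi>\<^sub>M ij \<in> {0, 1} \<times> {0, 1}. laplace (1 / \<epsilon>)) borel (cov_post D)"

end

theory Submission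
  imports Defs
begin

text \<open>
  Let \<open>a\<close>, \<open>b\<close>, \<open>m\<close> be the means of \<open>x\<close>, \<open>y\<close>, \<open>x y\<close> and \<open>c = m - a b\<close>. To first order
  the scaled error \<open>n (t - c)\<close> of the unclipped estimate \<open>t\<close> is a linear form \<open>L\<close> in the four
  noise variables; the squares of its coefficients sum to at most 1, so the second moment of
  \<open>L\<close> is at most \<open>2 / \<epsilon>\<^sup>2\<close>. With \<open>M\<close> the sum of the absolute noise values, the remainder is
  at most \<open>6 M\<^sup>2 / n\<close> if \<open>M \<le> n / 2\<close>; otherwise clipping bounds the scaled error by \<open>n / 2\<close>.
  Since \<open>n / 2 < M\<close> in that case, the square of the scaled error is always at most
  \<open>L\<^sup>2 + (14 + 50 M\<^sup>4) / n\<close>, and \<open>M\<close> has a finite fourth moment independent of the data.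
\<close>

section \<open>Inequalities for the means and for the first-order coefficients\<close>

text \<open>The hypotheses make the cells \<open>m\<close>, \<open>a - m\<close>,
  \<open>b - m\<close>, \<open>1 - a - b + m\<close> of a 2 by 2 table nonnegative. If
  \<open>m - a * b\<close> is nonnegative, it is at most \<open>a * (1 - b)\<close> and at most
  \<open>b * (1 - a)\<close>; if negative, its absolute value is at most \<open>a * b\<close> and at
  most \<open>(1 - a) * (1 - b)\<close>. Each pair multiplies to the right-hand side.\<close>

lemma joint_mean_cov_square_le:
  fixes a b m :: real
  assumes "0 \<le> m" "m \<le> a" "m \<le> b" "a + b - 1 \<le> m"
  shows "(m - a * b)\<^sup>2 \<le> a * (1 - a) * (b * (1 - b))"
proof (cases "m \<ge> a * b")
  case True
  have "m - a * b \<le> a * (1 - b)" "m - a * b \<le> b * (1 - a)"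
    using assms by (simp_all add: algebra_simps)
  then have "(m - a * b) * (m - a * b) \<le> (a * (1 - b)) * (b * (1 - a))"
    using True by (intro mult_mono) auto
  then show ?thesis by (simp add: power2_eq_square mult_ac)
next
  case False
  have "a * b - m \<le> a * b" "a * b - m \<le> (1 - a) * (1 - b)"
    using assms by (simp_all add: algebra_simps)
  then have "(a * b - m) * (a * b - m) \<le> (a * b) * ((1 - a) * (1 - b))"
    using False by (intro mult_mono) auto
  then show ?thesis by (simp add: power2_eq_square algebra_simps)
qed

text \<open>Places the true covariance in the clipping interval, so that clipping cannot increase
  the error.\<close>

lemma joint_mean_abs_cov_le:
  fixes a b m :: real
  assumes "0 \<le> m" "m \<le> a" "m \<le> b" "a + b - 1 \<le> m"
  shows "\<bar>m - a * b\<bar> \<le> 1 / 4"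
proof -
  have *: "t * (1 - t) \<le> 1 / 4" for t :: real
    using zero_le_power2[of "t - 1 / 2"] by (simp add: power2_eq_square algebra_simps)
  have "(m - a * b)\<^sup>2 \<le> a * (1 - a) * (b * (1 - b))"
    by (rule joint_mean_cov_square_le[OF assms])
  also have "\<dots> \<le> (1 / 4) * (1 / 4)"
    using assms by (intro mult_mono *) auto
  also have "\<dots> = (1 / 4)\<^sup>2" by (simp add: power2_eq_square)
  finally show ?thesis by (metis abs_le_square_iff abs_of_pos zero_less_divide_1_iff zero_less_numeral)
qed

text \<open>
  With \<open>\<alpha> = 1 - 2 a\<close>, \<open>\<beta> = 1 - 2 b\<close> and \<open>c = m - a b\<close> the sum equals
  \<open>4 c\<^sup>2 - 2 c \<alpha> \<beta> + (1 + \<alpha>\<^sup>2) (1 + \<beta>\<^sup>2) / 4\<close>, and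
  \<open>16 c\<^sup>2 \<le> (1 - \<alpha>\<^sup>2) (1 - \<beta>\<^sup>2)\<close>; the mixed term is bounded by AM-GM.
\<close>
lemma sensitivity_sum_squares_le:
  fixes a b m :: real
  assumes "0 \<le> m" "m \<le> a" "m \<le> b" "a + b - 1 \<le> m"
  defines "c \<equiv> m - a * b"
  shows "((1 - a) * (1 - b) - c)\<^sup>2 + (b * (1 - a) + c)\<^sup>2 + (a * (1 - b) + c)\<^sup>2 + (a * b - c)\<^sup>2 \<le> 1"
proof -
  define \<alpha> \<beta> where "\<alpha> = 1 - 2 * a" and "\<beta> = 1 - 2 * b"
  have ab: "a = (1 - \<alpha>) / 2" "b = (1 - \<beta>) / 2"
    by (simp_all add: \<alpha>_def \<beta>_def)
  have "\<alpha>\<^sup>2 \<le> 1" "\<beta>\<^sup>2 \<le> 1"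
    using assms by (auto simp: abs_square_le_1 \<alpha>_def \<beta>_def)
  then have A: "0 \<le> \<alpha>\<^sup>2" "\<alpha>\<^sup>2 \<le> 1" and B: "0 \<le> \<beta>\<^sup>2" "\<beta>\<^sup>2 \<le> 1" by auto
  have c2: "16 * c\<^sup>2 \<le> (1 - \<alpha>\<^sup>2) * (1 - \<beta>\<^sup>2)"
  proof -
    have "a * (1 - a) = (1 - \<alpha>\<^sup>2) / 4" "b * (1 - b) = (1 - \<beta>\<^sup>2) / 4"
      by (simp_all add: \<alpha>_def \<beta>_def field_simps power2_eq_square)
    with joint_mean_cov_square_le[OF assms(1-4)] show ?thesis by (simp add: c_def)
  qed
  \<comment> \<open>\<open>h\<close> is the arithmetic mean of two terms whose product bounds
    \<open>(4 * c * \<alpha> * \<beta>)\<^sup>2\<close>.\<close>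
  define h where "h = (\<alpha>\<^sup>2 * (1 - \<beta>\<^sup>2) + \<beta>\<^sup>2 * (1 - \<alpha>\<^sup>2)) / 2"
  have "0 \<le> h" using A B by (simp add: h_def)
  have "(4 * c * \<alpha> * \<beta>)\<^sup>2 = 16 * c\<^sup>2 * (\<alpha>\<^sup>2 * \<beta>\<^sup>2)" by (simp add: power_mult_distrib)
  also have "\<dots> \<le> (1 - \<alpha>\<^sup>2) * (1 - \<beta>\<^sup>2) * (\<alpha>\<^sup>2 * \<beta>\<^sup>2)"
    by (rule mult_right_mono[OF c2]) simp
  also have "\<dots> \<le> h\<^sup>2"
    using zero_le_power2[of "\<alpha>\<^sup>2 * (1 - \<beta>\<^sup>2) - \<beta>\<^sup>2 * (1 - \<alpha>\<^sup>2)"]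
    by (simp add: h_def power2_eq_square field_simps)
  finally have "\<bar>4 * c * \<alpha> * \<beta>\<bar> \<le> h"
    using \<open>0 \<le> h\<close> by (metis abs_le_square_iff abs_of_nonneg)
  then have "- (4 * c * \<alpha> * \<beta>) \<le> h" by linarith
  have "((1 - a) * (1 - b) - c)\<^sup>2 + (b * (1 - a) + c)\<^sup>2 + (a * (1 - b) + c)\<^sup>2 + (a * b - c)\<^sup>2
      = 4 * c\<^sup>2 - 2 * c * \<alpha> * \<beta> + (1 + \<alpha>\<^sup>2) * (1 + \<beta>\<^sup>2) / 4"
    unfolding ab by (simp add: field_simps power2_eq_square)
  also have "\<dots> \<le> (1 - \<alpha>\<^sup>2) * (1 - \<beta>\<^sup>2) / 4 + h / 2 + (1 + \<alpha>\<^sup>2) * (1 + \<beta>\<^sup>2) / 4"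
    using c2 \<open>- (4 * c * \<alpha> * \<beta>) \<le> h\<close> by simp
  \<comment> \<open>The products \<open>\<alpha>\<^sup>2 * \<beta>\<^sup>2\<close> cancel, which
    leaves a bound linear in the two squares.\<close>
  also have "\<dots> = 1 / 2 + \<alpha>\<^sup>2 / 4 + \<beta>\<^sup>2 / 4" by (simp add: h_def field_simps)
  also have "\<dots> \<le> 1" using A B by simp
  finally show ?thesis .
qed

section \<open>The error for fixed noise\<close>

lemma abs_clip_diff_le:
  assumes "l \<le> c" "c \<le> u"
  shows "\<bar>clip l u t - c\<bar> \<le> \<bar>t - c\<bar>"
  using assms by (auto simp: clip_def max_def min_def)

lemma abs_clip_diff_le_width:
  assumes "l \<le> c" "c \<le> u"
  shows "\<bar>clip l u t - c\<bar> \<le> u - l"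
  using assms by (auto simp: clip_def max_def min_def)

lemma abs_convex_comb_le:
  fixes a u v :: real
  assumes "0 \<le> a" "a \<le> 1"
  shows "\<bar>(1 - a) * u - a * v\<bar> \<le> \<bar>u\<bar> + \<bar>v\<bar>"
proof -
  have "(1 - a) * \<bar>u\<bar> \<le> 1 * \<bar>u\<bar>" "a * \<bar>v\<bar> \<le> 1 * \<bar>v\<bar>"
    using assms by (intro mult_right_mono; simp)+
  then show ?thesis
    using assms abs_triangle_ineq4[of "(1 - a) * u" "a * v"] by (simp add: abs_mult)
qed

text \<open>The coefficients of \<open>L\<close> are \<open>n\<close> times the partial derivatives
  of the unclipped estimate in the four counts, taken at zero noise.\<close>

lemma scaled_error_square_le:
  fixes a b m n z00 z01 z10 z11 :: real
  assumes m: "0 \<le> m" "m \<le> a" "m \<le> b" "a + b - 1 \<le> m" and n: "1 \<le> n"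
  defines "c \<equiv> m - a * b"
  defines "N \<equiv> n + (z00 + z01 + z10 + z11)"
  defines "t \<equiv> (n * m + z11) / N - (n * a + z10 + z11) / N * ((n * b + z01 + z11) / N)"
  defines "L \<equiv> ((1 - a) * (1 - b) - c) * z11 - (b * (1 - a) + c) * z10
              - (a * (1 - b) + c) * z01 + (a * b - c) * z00"
  defines "M \<equiv> \<bar>z00\<bar> + \<bar>z01\<bar> + \<bar>z10\<bar> + \<bar>z11\<bar>"
  shows "n\<^sup>2 * (clip (- 1 / 4) (1 / 4) t - c)\<^sup>2 \<le> L\<^sup>2 + (14 + 50 * M ^ 4) / n"
proof -
  have c: "- 1 / 4 \<le> c" "c \<le> 1 / 4"
    using joint_mean_abs_cov_le[OF m] unfolding c_def by linarith+
  have a: "0 \<le> a" "a \<le> 1" and b: "0 \<le> b" "b \<le> 1" using m by auto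
  have M0: "0 \<le> M" by (simp add: M_def)
  \<comment> \<open>Absorbs cubic terms, so that only the fourth moment of \<open>M\<close> has to
    be controlled.\<close>
  have M3: "M ^ 3 \<le> 1 + M ^ 4"
  proof (cases "M \<le> 1")
    case True
    then have "M ^ 3 \<le> 1" using M0 by (simp add: power_le_one)
    moreover have "0 \<le> M ^ 4" using M0 by simp
    ultimately show ?thesis by linarith
  next
    case False
    then have "M ^ 3 \<le> M ^ 4" by (intro power_increasing) auto
    then show ?thesis by simp
  qed
  show ?thesis
  proof (cases "M \<le> n / 2")
    case False
    have "(clip (- 1 / 4) (1 / 4) t - c)\<^sup>2 \<le> (1 / 2)\<^sup>2"
      using abs_clip_diff_le_width[OF c, of t] by (intro power2_le_iff_abs_le[THEN iffD2]) auto
    then have "n\<^sup>2 * (clip (- 1 / 4) (1 / 4) t - c)\<^sup>2 \<le> n\<^sup>2 * (1 / 2)\<^sup>2"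
      by (rule mult_left_mono) simp
    \<comment> \<open>One factor \<open>n / 2\<close> is split off to be traded for
      \<open>M\<close>; this produces the decay \<open>1 / n\<close>.\<close>
    also have "\<dots> = 2 * (n / 2) ^ 3 / n"
      using n by (simp add: power2_eq_square power3_eq_cube)
    also have "\<dots> \<le> 2 * M ^ 3 / n"
      using n False by (intro divide_right_mono mult_left_mono power_mono) auto
    also have "\<dots> \<le> (14 + 50 * M ^ 4) / n"
      using n M3 zero_le_power[OF M0, of 4] by (intro divide_right_mono) linarith+
    also have "\<dots> \<le> L\<^sup>2 + (14 + 50 * M ^ 4) / n" by simp
    finally show ?thesis .
  next
    case True
    define W where "W = z00 + z01 + z10 + z11"
    \<comment> \<open>\<open>Y\<close> is the noise in the x-sum minus \<open>a * W\<close>, so the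
      noisy mean is exactly \<open>a + Y / N\<close>; \<open>V\<close> is the analogue for y.
      Grouped this way, each noise variable has a coefficient of absolute value at most 1, whence
      the bound \<open>M\<close>.\<close>
    define Y where "Y = (1 - a) * (z10 + z11) - a * (z00 + z01)"
    define V where "V = (1 - b) * (z01 + z11) - b * (z00 + z10)"
    have W: "\<bar>W\<bar> \<le> M" unfolding W_def M_def by linarith
    have N: "n / 2 \<le> N" "0 < N" using W True n unfolding N_def W_def by linarith+
    have Y: "\<bar>Y\<bar> \<le> M"
      using abs_convex_comb_le[OF a, of "z10 + z11" "z00 + z01"] unfolding Y_def M_def by linarith
    have V: "\<bar>V\<bar> \<le> M"
      using abs_convex_comb_le[OF b, of "z01 + z11" "z00 + z10"] unfolding V_def M_def by linarith
    have L: "\<bar>L\<bar> \<le> M"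
    proof -
      define p q r s where "p = (1 - a) * (1 - b) - c" and "q = b * (1 - a) + c"
        and "r = a * (1 - b) + c" and "s = a * b - c"
      have S: "p\<^sup>2 + q\<^sup>2 + r\<^sup>2 + s\<^sup>2 \<le> 1"
        using sensitivity_sum_squares_le[OF m] by (simp add: p_def q_def r_def s_def c_def)
      have "0 \<le> p\<^sup>2" "0 \<le> q\<^sup>2" "0 \<le> r\<^sup>2" "0 \<le> s\<^sup>2" by simp_all
      with S have "p\<^sup>2 \<le> 1" "q\<^sup>2 \<le> 1" "r\<^sup>2 \<le> 1" "s\<^sup>2 \<le> 1" by linarith+
      then have "\<bar>p\<bar> \<le> 1" "\<bar>q\<bar> \<le> 1" "\<bar>r\<bar> \<le> 1" "\<bar>s\<bar> \<le> 1" by (auto simp: abs_square_le_1)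
      then have "\<bar>p * z11\<bar> \<le> \<bar>z11\<bar>" "\<bar>q * z10\<bar> \<le> \<bar>z10\<bar>" "\<bar>r * z01\<bar> \<le> \<bar>z01\<bar>" "\<bar>s * z00\<bar> \<le> \<bar>z00\<bar>"
        by (auto simp: abs_mult intro: mult_left_le_one_le)
      then show ?thesis unfolding L_def p_def[symmetric] q_def[symmetric] r_def[symmetric]
        s_def[symmetric] M_def by linarith
    qed
    have sxy: "(n * m + z11) / N = m + (z11 - m * W) / N"
      and sx: "(n * a + z10 + z11) / N = a + Y / N"
      and sy: "(n * b + z01 + z11) / N = b + V / N"
      using N(2) by (simp_all add: N_def Y_def V_def W_def field_simps)
    \<comment> \<open>Expanding the product of the noisy means is exact: the terms over
      \<open>N\<close> collect to \<open>L\<close>, and only \<open>Y * V / N\<^sup>2\<close>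
      remains.\<close>
    have "t - c = (z11 - m * W - a * V - b * Y) / N - Y / N * (V / N)"
      unfolding t_def sxy sx sy c_def by (simp add: field_simps add_divide_distrib diff_divide_distrib)
    also have "z11 - m * W - a * V - b * Y = L"
      by (simp add: L_def W_def Y_def V_def c_def algebra_simps)
    finally have tc: "t - c = L / N - Y / N * (V / N)" .
    \<comment> \<open>Writing \<open>n\<close> as \<open>N - W\<close> turns
      \<open>n * L / N\<close> into \<open>L - L * W / N\<close>. Both remaining terms are quadratic
      in the noise and of order \<open>1 / n\<close>.\<close>
    have "n * (t - c) - L = - (L * W / N) - n * (Y * V) / (N * N)"
    proof -
      have nW: "n = N - W" by (simp add: N_def W_def)
      have "n * (L / N) - L = - (L * W / N)"
        using N(2) by (subst nW) (simp add: field_simps)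
      then show ?thesis unfolding tc by (simp add: algebra_simps)
    qed
    also have "\<bar>\<dots>\<bar> \<le> \<bar>L * W / N\<bar> + \<bar>n * (Y * V) / (N * N)\<bar>"
      by (metis abs_minus_cancel abs_triangle_ineq4)
    also have "\<bar>L * W / N\<bar> \<le> M * M / (n / 2)"
      unfolding abs_divide abs_mult using L W N n M0 by (intro frac_le mult_mono) auto
    also have "\<bar>n * (Y * V) / (N * N)\<bar> \<le> n * (M * M) / ((n / 2) * (n / 2))"
      unfolding abs_divide abs_mult using Y V N n M0 by (intro frac_le mult_mono) auto
    also have "M * M / (n / 2) + n * (M * M) / ((n / 2) * (n / 2)) = 6 * M\<^sup>2 / n"
      using n by (simp add: field_simps power2_eq_square)
    finally have d: "\<bar>n * (t - c) - L\<bar> \<le> 6 * M\<^sup>2 / n" by simp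
    define d where "d = n * (t - c) - L"
    define e where "e = 6 * M\<^sup>2 / n"
    have de: "\<bar>d\<bar> \<le> e" using d by (simp add: d_def e_def)
    have "n\<^sup>2 * (clip (- 1 / 4) (1 / 4) t - c)\<^sup>2 \<le> n\<^sup>2 * (t - c)\<^sup>2"
      using abs_clip_diff_le[OF c, of t] by (intro mult_left_mono) (auto simp: abs_le_square_iff)
    also have "\<dots> = (L + d)\<^sup>2" by (simp add: d_def power_mult_distrib)
    also have "\<dots> = L\<^sup>2 + 2 * (L * d) + d\<^sup>2" by (simp add: power2_sum)
    also have "\<dots> \<le> L\<^sup>2 + 2 * (M * e) + e\<^sup>2"
    proof -
      have "\<bar>L * d\<bar> \<le> M * e" unfolding abs_mult using L de M0 by (intro mult_mono) auto
      moreover have "d\<^sup>2 \<le> e\<^sup>2" using de by (rule power2_le_iff_abs_le[THEN iffD2, rotated]) (use de in linarith)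
      ultimately show ?thesis by linarith
    qed
    also have "\<dots> = L\<^sup>2 + (12 * M ^ 3 + 36 * M ^ 4 / n) / n"
      using n by (simp add: e_def field_simps power2_eq_square power3_eq_cube power4_eq_xxxx)
    \<comment> \<open>By \<open>M3\<close> this case needs only \<open>12 + 48 * M ^ 4\<close> in
      the numerator and the clipped case only \<open>2 + 2 * M ^ 4\<close>; the constants 14 and 50
      cover both.\<close>
    also have "\<dots> \<le> L\<^sup>2 + (14 + 50 * M ^ 4) / n"
    proof -
      have "36 * M ^ 4 / n \<le> 36 * M ^ 4 / 1" using n M0 by (intro divide_left_mono) auto
      then have "12 * M ^ 3 + 36 * M ^ 4 / n \<le> 14 + 50 * M ^ 4"
        using M3 zero_le_power[OF M0, of 4] by linarith
      then show ?thesis using n by (simp add: divide_right_mono)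
    qed
    finally show ?thesis .
  qed
qed

lemma sum_list_case_prod_linear:
  fixes D :: "(real \<times> real) list"
  shows "(\<Sum>(x, y)\<leftarrow>D. x * (1 - y)) = (\<Sum>(x, y)\<leftarrow>D. x) - (\<Sum>(x, y)\<leftarrow>D. x * y)"
    and "(\<Sum>(x, y)\<leftarrow>D. (1 - x) * y) = (\<Sum>(x, y)\<leftarrow>D. y) - (\<Sum>(x, y)\<leftarrow>D. x * y)"
    and "(\<Sum>(x, y)\<leftarrow>D. (1 - x) * (1 - y)) =
      real (length D) - (\<Sum>(x, y)\<leftarrow>D. x) - (\<Sum>(x, y)\<leftarrow>D. y) + (\<Sum>(x, y)\<leftarrow>D. x * y)"
  by (induction D; auto simp: algebra_simps)+

section \<open>Moments of the Laplace distribution\<close>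

text \<open>The Laplace density is the average of the exponential density of rate
  \<open>1 / b\<close> and its reflection, so the absolute moments are the exponential ones.\<close>

lemma nn_integral_laplace_abs_power:
  assumes "b > 0"
  shows "(\<integral>\<^sup>+t. ennreal (\<bar>t\<bar> ^ k) \<partial>laplace b) = ennreal (fact k * b ^ k)"
proof -
  define h where "h = (\<lambda>t. ennreal (exponential_density (1 / b) t * t ^ k))"
  define g where "g = (\<lambda>t. ennreal (1 / (2 * b) * exp (- \<bar>t\<bar> / b)) * ennreal (\<bar>t\<bar> ^ k))"
  have h [measurable]: "h \<in> borel_measurable borel" by (simp add: h_def)
  have g [measurable]: "g \<in> borel_measurable borel" by (simp add: g_def)
  have H: "(\<integral>\<^sup>+t. h t \<partial>lborel) = ennreal (fact k * b ^ k)"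
    using nn_integral_erlang_ith_moment[of "1 / b" 0 k] assms
    by (simp add: h_def power_divide)
  have "(\<integral>\<^sup>+t. h (- t) \<partial>lborel) = (\<integral>\<^sup>+t. h t \<partial>lborel)"
    using nn_integral_real_affine[of h "-1" 0] by simp
  then have "2 * ennreal (fact k * b ^ k) = (\<integral>\<^sup>+t. h t + h (- t) \<partial>lborel)"
    by (subst nn_integral_add) (auto simp: H mult_2)
  \<comment> \<open>At \<open>t = 0\<close> both halves are positive when \<open>k = 0\<close> and
    the identity fails, so it is claimed almost everywhere.\<close>
  moreover have "AE t in lborel. h t + h (- t) = 2 * g t"
    using AE_lborel_singleton[of 0]
  proof eventually_elim
    case (elim t)
    have "h t + h (- t) = ennreal (2 * (1 / (2 * b) * exp (- \<bar>t\<bar> / b) * \<bar>t\<bar> ^ k))"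
      using elim assms by (auto simp: h_def exponential_density_def abs_if)
    also have "\<dots> = 2 * g t"
      unfolding g_def using assms by (simp add: ennreal_mult'[symmetric] flip: ennreal_numeral)
    finally show ?case .
  qed
  then have "(\<integral>\<^sup>+t. h t + h (- t) \<partial>lborel) = 2 * (\<integral>\<^sup>+t. g t \<partial>lborel)"
    by (subst nn_integral_cong_AE) (auto simp: nn_integral_cmult)
  ultimately have "(\<integral>\<^sup>+t. g t \<partial>lborel) = ennreal (fact k * b ^ k)"
    by (simp add: ennreal_mult_cancel_left)
  then show ?thesis
    unfolding laplace_def by (subst nn_integral_density) (auto simp: g_def)
qed

lemma sets_laplace [measurable_cong, simp]: "sets (laplace b) = sets borel"
  by (simp add: laplace_def)

lemma integrable_laplace_power:
  assumes "b > 0"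
  shows "integrable (laplace b) (\<lambda>t. t ^ k)"
proof (rule integrableI_bounded)
  show "(\<integral>\<^sup>+t. ennreal (norm (t ^ k)) \<partial>laplace b) < \<infinity>"
    using nn_integral_laplace_abs_power[OF assms, of k] by (simp add: power_abs)
qed measurable

text \<open>The substitution of \<open>-t\<close> for \<open>t\<close> turns the integral into its
  negative.\<close>

lemma integral_laplace_id:
  assumes "b > 0"
  shows "(\<integral>t. t \<partial>laplace b) = 0"
proof -
  define I where "I = (\<integral>t. 1 / (2 * b) * exp (- \<bar>t\<bar> / b) * t \<partial>lborel)"
  have "I = (\<integral>t. - (1 / (2 * b) * exp (- \<bar>t\<bar> / b) * t) \<partial>lborel)"
    unfolding I_def by (subst lborel_integral_real_affine[of "-1" _ 0]) auto
  also have "\<dots> = - I" unfolding I_def by (rule integral_minus)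
  finally have "I = 0" by simp
  then show ?thesis
    using assms unfolding laplace_def I_def by (subst integral_density) auto
qed

lemma integral_laplace_square:
  assumes "b > 0"
  shows "(\<integral>t. t\<^sup>2 \<partial>laplace b) = 2 * b\<^sup>2"
  using nn_integral_laplace_abs_power[OF assms, of 2] assms
  by (subst integral_eq_nn_integral) (auto simp: fact_numeral)

section \<open>Moments of finitely many independent Laplace variables\<close>

context
  fixes I :: "'i set" and b :: real
  assumes I: "finite I" and b: "b > 0"
begin

interpretation laplace: prob_space "laplace b"
  using b by (rule prob_space_laplace)

interpretation product_prob_space "\<lambda>_. laplace b" I
  by standard

lemma
  assumes i: "i \<in> I" and f: "integrable (laplace b) (f :: real \<Rightarrow> real)"
  shows integrable_PiM_laplace_component: "integrable (Pi\<^sub>M I (\<lambda>_. laplace b)) (\<lambda>Z. f (Z i))"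
    and integral_PiM_laplace_component:
      "(\<integral>Z. f (Z i) \<partial>Pi\<^sub>M I (\<lambda>_. laplace b)) = (\<integral>t. f t \<partial>laplace b)"
proof -
  have *: "distr (Pi\<^sub>M I (\<lambda>_. laplace b)) (laplace b) (\<lambda>Z. Z i) = laplace b"
    by (rule distr_PiM_component) (use i laplace.prob_space_axioms in auto)
  have [measurable]: "f \<in> borel_measurable (laplace b)" using f by auto
  show "integrable (Pi\<^sub>M I (\<lambda>_. laplace b)) (\<lambda>Z. f (Z i))"
    using f i by (subst (asm) *[symmetric], subst (asm) integrable_distr_eq) auto
  show "(\<integral>Z. f (Z i) \<partial>Pi\<^sub>M I (\<lambda>_. laplace b)) = (\<integral>t. f t \<partial>laplace b)"
    using i by (subst (2) *[symmetric], subst integral_distr) auto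
qed

lemma
  assumes ij: "i \<in> I" "j \<in> I"
  shows integrable_PiM_laplace_mult: "integrable (Pi\<^sub>M I (\<lambda>_. laplace b)) (\<lambda>Z. Z i * Z j)"
    and integral_PiM_laplace_mult:
      "(\<integral>Z. Z i * Z j \<partial>Pi\<^sub>M I (\<lambda>_. laplace b)) = (if i = j then 2 * b\<^sup>2 else 0)"
proof -
  have int1: "integrable (laplace b) (\<lambda>t. t)"
    using integrable_laplace_power[OF b, of 1] by simp
  have "integrable (Pi\<^sub>M I (\<lambda>_. laplace b)) (\<lambda>Z. Z i * Z j) \<and>
    (\<integral>Z. Z i * Z j \<partial>Pi\<^sub>M I (\<lambda>_. laplace b)) = (if i = j then 2 * b\<^sup>2 else 0)"
  proof (cases "i = j")
    case True
    then show ?thesis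
      using integrable_PiM_laplace_component[OF ij(1) integrable_laplace_power[OF b, of 2]]
        integral_PiM_laplace_component[OF ij(1) integrable_laplace_power[OF b, of 2]]
        integral_laplace_square[OF b]
      by (simp add: power2_eq_square)
  next
    case False
    \<comment> \<open>Padding with the constant 1 writes \<open>Z i * Z j\<close> as a product over
      all coordinates. Its integral then factorizes, and the factor at \<open>i\<close> is a
      vanishing mean.\<close>
    define f where "f = (\<lambda>k t. if k = i \<or> k = j then t else 1 :: real)"
    have intf: "integrable (laplace b) (f k)" for k
      using int1 by (cases "k = i \<or> k = j") (simp_all add: f_def)
    have prod_ij: "(\<Prod>k\<in>I. c k) = c i * c j" if "\<And>k. k \<in> I - {i, j} \<Longrightarrow> c k = 1" for c :: "'i \<Rightarrow> real"
    proof -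
      have "prod c {i, j} = prod c I"
        using I ij that by (intro prod.mono_neutral_left) auto
      then show ?thesis using False by simp
    qed
    have "(\<Prod>k\<in>I. f k (Z k)) = Z i * Z j" for Z
      by (subst prod_ij) (auto simp: f_def)
    moreover have "(\<Prod>k\<in>I. \<integral>t. f k t \<partial>laplace b) = 0"
      using integral_laplace_id[OF b] I ij(1) by (intro prod_zero bexI[of _ i]) (auto simp: f_def)
    ultimately show ?thesis
      using product_integrable_prod[of I f, OF I intf]
        product_integral_prod[of I f, OF I intf] False by simp
  qed
  then show "integrable (Pi\<^sub>M I (\<lambda>_. laplace b)) (\<lambda>Z. Z i * Z j)"
    "(\<integral>Z. Z i * Z j \<partial>Pi\<^sub>M I (\<lambda>_. laplace b)) = (if i = j then 2 * b\<^sup>2 else 0)" by auto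
qed

text \<open>After expanding the square, independence and zero means leave only the diagonal.\<close>

lemma
  fixes p :: "'i \<Rightarrow> real"
  shows integrable_PiM_laplace_linear_square:
      "integrable (Pi\<^sub>M I (\<lambda>_. laplace b)) (\<lambda>Z. (\<Sum>i\<in>I. p i * Z i)\<^sup>2)"
    and integral_PiM_laplace_linear_square:
      "(\<integral>Z. (\<Sum>i\<in>I. p i * Z i)\<^sup>2 \<partial>Pi\<^sub>M I (\<lambda>_. laplace b)) = 2 * b\<^sup>2 * (\<Sum>i\<in>I. (p i)\<^sup>2)"
proof -
  have eq: "(\<Sum>i\<in>I. p i * Z i)\<^sup>2 = (\<Sum>i\<in>I. \<Sum>j\<in>I. p i * p j * (Z i * Z j))" for Z
    by (simp add: power2_eq_square sum_product mult_ac)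
  have int: "integrable (Pi\<^sub>M I (\<lambda>_. laplace b)) (\<lambda>Z. p i * p j * (Z i * Z j))"
    if "i \<in> I" "j \<in> I" for i j
    using integrable_PiM_laplace_mult[OF that] by simp
  show "integrable (Pi\<^sub>M I (\<lambda>_. laplace b)) (\<lambda>Z. (\<Sum>i\<in>I. p i * Z i)\<^sup>2)"
    unfolding eq using int by (intro Bochner_Integration.integrable_sum) auto
  have "(\<integral>Z. (\<Sum>i\<in>I. p i * Z i)\<^sup>2 \<partial>Pi\<^sub>M I (\<lambda>_. laplace b))
      = (\<Sum>i\<in>I. \<Sum>j\<in>I. \<integral>Z. p i * p j * (Z i * Z j) \<partial>Pi\<^sub>M I (\<lambda>_. laplace b))"
    unfolding eq using int
    by (simp add: Bochner_Integration.integral_sum Bochner_Integration.integrable_sum)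
  also have "\<dots> = (\<Sum>i\<in>I. \<Sum>j\<in>I. if i = j then p i * p j * (2 * b\<^sup>2) else 0)"
    using integral_PiM_laplace_mult by (intro sum.cong) auto
  also have "\<dots> = 2 * b\<^sup>2 * (\<Sum>i\<in>I. (p i)\<^sup>2)"
    using I by (simp add: sum_distrib_left power2_eq_square mult_ac)
  finally show "(\<integral>Z. (\<Sum>i\<in>I. p i * Z i)\<^sup>2 \<partial>Pi\<^sub>M I (\<lambda>_. laplace b)) = 2 * b\<^sup>2 * (\<Sum>i\<in>I. (p i)\<^sup>2)" .
qed

text \<open>Cauchy-Schwarz against the constant 1, applied twice, bounds the fourth power by
  \<open>card I ^ 3\<close> times the sum of the fourth powers, which are integrable
  coordinatewise.\<close>

lemma integrable_PiM_laplace_abs_sum_power4: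
  "integrable (Pi\<^sub>M I (\<lambda>_. laplace b)) (\<lambda>Z. (\<Sum>i\<in>I. \<bar>Z i\<bar>) ^ 4)"
proof (rule Bochner_Integration.integrable_bound)
  show "integrable (Pi\<^sub>M I (\<lambda>_. laplace b)) (\<lambda>Z. real (card I) ^ 3 * (\<Sum>i\<in>I. Z i ^ 4))"
    using integrable_PiM_laplace_component[OF _ integrable_laplace_power[OF b]]
    by (intro integrable_mult_right Bochner_Integration.integrable_sum) auto
  have "(\<Sum>i\<in>I. \<bar>Z i\<bar>) ^ 4 \<le> real (card I) ^ 3 * (\<Sum>i\<in>I. Z i ^ 4)" for Z :: "'i \<Rightarrow> real"
  proof -
    have cs: "(\<Sum>i\<in>I. u i)\<^sup>2 \<le> real (card I) * (\<Sum>i\<in>I. (u i)\<^sup>2)" for u :: "'i \<Rightarrow> real"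
      using Cauchy_Schwarz_ineq_sum[of "\<lambda>_. 1" u I] by simp
    have "((\<Sum>i\<in>I. \<bar>Z i\<bar>)\<^sup>2)\<^sup>2 \<le> (real (card I) * (\<Sum>i\<in>I. (Z i)\<^sup>2))\<^sup>2"
      using cs[of "\<lambda>i. \<bar>Z i\<bar>"] by (intro power_mono) auto
    also have "\<dots> \<le> (real (card I))\<^sup>2 * (real (card I) * (\<Sum>i\<in>I. ((Z i)\<^sup>2)\<^sup>2))"
      unfolding power_mult_distrib using cs[of "\<lambda>i. (Z i)\<^sup>2"] by (intro mult_left_mono) auto
    finally show ?thesis
      by (simp add: power4_eq_xxxx power3_eq_cube power2_eq_square mult_ac)
  qed
  then show "AE Z in Pi\<^sub>M I (\<lambda>_. laplace b).
      norm ((\<Sum>i\<in>I. \<bar>Z i\<bar>) ^ 4) \<le> norm (real (card I) ^ 3 * (\<Sum>i\<in>I. Z i ^ 4))"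
    by (intro AE_I2) (simp add: abs_of_nonneg sum_nonneg)
qed measurable

end

section \<open>From fixed noise to the risk\<close>

text \<open>The coefficients \<open>p\<close> are chosen before \<open>Z\<close>: they depend on the
  data alone, so the bound can be integrated over the noise.\<close>

lemma cov_post_error_square_le:
  assumes D: "set D \<subseteq> {0..1} \<times> {0..1}" "D \<noteq> []"
  obtains p :: "nat \<times> nat \<Rightarrow> real"
  where "(\<Sum>ij\<in>{0, 1} \<times> {0, 1}. (p ij)\<^sup>2) \<le> 1"
    and "\<And>Z. (real (length D))\<^sup>2 * (cov_post D Z - cov D)\<^sup>2
      \<le> (\<Sum>ij\<in>{0, 1} \<times> {0, 1}. p ij * Z ij)\<^sup>2
        + (14 + 50 * (\<Sum>ij\<in>{0, 1} \<times> {0, 1}. \<bar>Z ij\<bar>) ^ 4) / real (length D)"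
proof -
  define n where "n = real (length D)"
  have n: "1 \<le> n" using D(2) by (cases D) (auto simp: n_def)
  define a b m where "a = (\<Sum>(x, y)\<leftarrow>D. x) / n" and "b = (\<Sum>(x, y)\<leftarrow>D. y) / n"
    and "m = (\<Sum>(x, y)\<leftarrow>D. x * y) / n"
  have S: "(\<Sum>(x, y)\<leftarrow>D. x) = n * a" "(\<Sum>(x, y)\<leftarrow>D. y) = n * b" "(\<Sum>(x, y)\<leftarrow>D. x * y) = n * m"
    using n by (simp_all add: a_def b_def m_def)
  note S' = sum_list_case_prod_linear[of D, unfolded S n_def[symmetric]]
  \<comment> \<open>Nonnegativity of the four noiseless cell sums gives exactly the four conditions
    on \<open>a\<close>, \<open>b\<close>, \<open>m\<close>.\<close>
  have nonneg: "0 \<le> (\<Sum>(x, y)\<leftarrow>D. f x y)" if "\<And>x y. x \<in> {0..1} \<Longrightarrow> y \<in> {0..1} \<Longrightarrow> 0 \<le> f x y"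
    for f :: "real \<Rightarrow> real \<Rightarrow> real"
    using D(1) that by (intro sum_list_nonneg) auto
  have "0 \<le> n * m"
    unfolding S(3)[symmetric] by (intro nonneg) simp
  moreover have "0 \<le> n * a - n * m" "0 \<le> n * b - n * m" "0 \<le> n - n * a - n * b + n * m"
    unfolding S'[symmetric] by (intro nonneg; simp)+
  ultimately have "0 \<le> n * m" "0 \<le> n * (a - m)" "0 \<le> n * (b - m)" "0 \<le> n * (1 - a - b + m)"
    by (simp_all add: algebra_simps)
  then have m: "0 \<le> m" "m \<le> a" "m \<le> b" "a + b - 1 \<le> m"
    using n by (auto simp: zero_le_mult_iff)
  define c where "c = m - a * b"
  have c: "cov D = c"
    by (simp add: cov_def c_def a_def b_def m_def n_def)
  define p :: "nat \<times> nat \<Rightarrow> real" where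
    "p = (\<lambda>(i, j). if i = 1 then if j = 1 then (1 - a) * (1 - b) - c else - (b * (1 - a) + c)
           else if j = 1 then - (a * (1 - b) + c) else a * b - c)"
  have I: "{0, 1} \<times> {0, 1} = {(0, 0), (0, 1), (1, 0), (1, 1 :: nat)}" by auto
  show ?thesis
  proof (rule that[of p])
    show "(\<Sum>ij\<in>{0, 1} \<times> {0, 1}. (p ij)\<^sup>2) \<le> 1"
      using sensitivity_sum_squares_le[OF m] unfolding I c_def[symmetric]
      by (simp add: p_def ac_simps del: minus_add_distrib add_uminus_conv_diff)
    show "(real (length D))\<^sup>2 * (cov_post D Z - cov D)\<^sup>2
      \<le> (\<Sum>ij\<in>{0, 1} \<times> {0, 1}. p ij * Z ij)\<^sup>2
        + (14 + 50 * (\<Sum>ij\<in>{0, 1} \<times> {0, 1}. \<bar>Z ij\<bar>) ^ 4) / real (length D)" for Z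
    proof -
      let ?N = "n + (Z (0, 0) + Z (0, 1) + Z (1, 0) + Z (1, 1))"
      have "cov_post D Z = clip (- 1 / 4) (1 / 4) ((n * m + Z (1, 1)) / ?N
          - (n * a + Z (1, 0) + Z (1, 1)) / ?N * ((n * b + Z (0, 1) + Z (1, 1)) / ?N))"
        unfolding cov_post_def S' S(3) Let_def by (simp add: algebra_simps)
      then show ?thesis
        using scaled_error_square_le[OF m n, of "Z (1, 1)" "Z (0, 0)" "Z (0, 1)" "Z (1, 0)"]
        unfolding I c c_def[symmetric] n_def[symmetric]
        by (simp add: p_def algebra_simps)
    qed
  qed
qed

text \<open>The data enter the bound only through their number, since \<open>K\<close> depends on
  the noise law alone; this makes the supremum over datasets harmless.\<close>

lemma risk_cov_est_le:
  fixes \<epsilon> :: real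
  assumes \<epsilon>: "\<epsilon> > 0" and D: "set D \<subseteq> {0..1} \<times> {0..1}" "D \<noteq> []"
  defines "P \<equiv> \<Pi>\<^sub>M ij \<in> {0, 1 :: nat} \<times> {0, 1 :: nat}. laplace (1 / \<epsilon>)"
  defines "K \<equiv> \<integral>Z. (\<Sum>ij\<in>{0, 1} \<times> {0, 1}. \<bar>Z ij\<bar>) ^ 4 \<partial>P"
  shows "risk (cov_est \<epsilon>) cov D \<le> ennreal (2 / \<epsilon>\<^sup>2 + (14 + 50 * K) / real (length D))"
proof -
  let ?I = "{0, 1 :: nat} \<times> {0, 1 :: nat}" and ?n = "real (length D)"
  obtain p :: "nat \<times> nat \<Rightarrow> real" where p: "(\<Sum>ij\<in>?I. (p ij)\<^sup>2) \<le> 1"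
    and le: "\<And>Z. ?n\<^sup>2 * (cov_post D Z - cov D)\<^sup>2
      \<le> (\<Sum>ij\<in>?I. p ij * Z ij)\<^sup>2 + (14 + 50 * (\<Sum>ij\<in>?I. \<bar>Z ij\<bar>) ^ 4) / ?n"
    using cov_post_error_square_le[OF D] by blast
  have I: "finite ?I" and b: "1 / \<epsilon> > 0" using \<epsilon> by auto
  interpret laplace: prob_space "laplace (1 / \<epsilon>)" by (rule prob_space_laplace[OF b])
  interpret P: prob_space P unfolding P_def by (intro prob_space_PiM laplace.prob_space_axioms)
  have [measurable]: "cov_post D \<in> borel_measurable P"
    unfolding P_def by (rule measurable_cov_post)
  have int2: "integrable P (\<lambda>Z. (\<Sum>ij\<in>?I. p ij * Z ij)\<^sup>2)"
    unfolding P_def by (rule integrable_PiM_laplace_linear_square[OF I b])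
  have int4: "integrable P (\<lambda>Z. (\<Sum>ij\<in>?I. \<bar>Z ij\<bar>) ^ 4)"
    unfolding P_def by (rule integrable_PiM_laplace_abs_sum_power4[OF I b])
  have "risk (cov_est \<epsilon>) cov D
      = (of_nat (length D))\<^sup>2 * (\<integral>\<^sup>+Z. ennreal ((cov_post D Z - cov D)\<^sup>2) \<partial>P)"
    unfolding risk_def cov_est_def P_def[symmetric] by (subst nn_integral_distr) auto
  also have "\<dots> = (\<integral>\<^sup>+Z. ennreal (?n\<^sup>2 * (cov_post D Z - cov D)\<^sup>2) \<partial>P)"
    by (subst nn_integral_cmult[symmetric])
       (auto simp: ennreal_mult ennreal_of_nat_eq_real_of_nat ennreal_power)
  also have "\<dots> \<le> (\<integral>\<^sup>+Z. ennreal ((\<Sum>ij\<in>?I. p ij * Z ij)\<^sup>2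
      + (14 + 50 * (\<Sum>ij\<in>?I. \<bar>Z ij\<bar>) ^ 4) / ?n) \<partial>P)"
    by (intro nn_integral_mono ennreal_leI le)
  also have "\<dots> = ennreal (\<integral>Z. (\<Sum>ij\<in>?I. p ij * Z ij)\<^sup>2
      + (14 + 50 * (\<Sum>ij\<in>?I. \<bar>Z ij\<bar>) ^ 4) / ?n \<partial>P)"
    using int2 int4 by (intro nn_integral_eq_integral) (auto simp: sum_nonneg simp del: sum.insert)
  also have "(\<integral>Z. (\<Sum>ij\<in>?I. p ij * Z ij)\<^sup>2
      + (14 + 50 * (\<Sum>ij\<in>?I. \<bar>Z ij\<bar>) ^ 4) / ?n \<partial>P)
      = (\<integral>Z. (\<Sum>ij\<in>?I. p ij * Z ij)\<^sup>2 \<partial>P) + (14 + 50 * K) / ?n"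
    using int2 int4 by (simp add: K_def P.prob_space)
  also have "(\<integral>Z. (\<Sum>ij\<in>?I. p ij * Z ij)\<^sup>2 \<partial>P) = 2 * (1 / \<epsilon>)\<^sup>2 * (\<Sum>ij\<in>?I. (p ij)\<^sup>2)"
    unfolding P_def by (rule integral_PiM_laplace_linear_square[OF I b])
  also have "2 * (1 / \<epsilon>)\<^sup>2 * (\<Sum>ij\<in>?I. (p ij)\<^sup>2) \<le> 2 * (1 / \<epsilon>)\<^sup>2 * 1"
    by (intro mult_left_mono p) auto
  also have "2 * (1 / \<epsilon>)\<^sup>2 * 1 = 2 / \<epsilon>\<^sup>2" by (simp add: power_divide)
  finally show ?thesis by (simp add: ennreal_leI)
qed

theorem theorem3:
  fixes \<epsilon> :: real
  assumes "\<epsilon> > 0"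
  shows "\<exists>r :: nat \<Rightarrow> real. r \<longlonglongrightarrow> 0 \<and>
    (\<forall>n0 \<ge> 1. worst_risk ({0..1} \<times> {0..1}) (cov_est \<epsilon>) cov n0
                \<le> ennreal (2 / \<epsilon>\<^sup>2 * (1 + r n0)))"
proof -
  define K where "K = (\<integral>Z. (\<Sum>ij\<in>{0, 1} \<times> {0, 1}. \<bar>Z ij\<bar>) ^ 4
    \<partial>(\<Pi>\<^sub>M ij \<in> {0, 1 :: nat} \<times> {0, 1 :: nat}. laplace (1 / \<epsilon>)))"
  define C where "C = 14 + 50 * K"
  \<comment> \<open>The sign of \<open>C\<close> makes \<open>C / n\<close> nonincreasing in the
    number of records, so the bound is worst at \<open>n0\<close>.\<close>
  have "0 \<le> K" unfolding K_def by (intro integral_nonneg_AE AE_I2) (simp add: sum_nonneg)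
  then have C: "0 \<le> C" by (simp add: C_def)
  \<comment> \<open>Solves \<open>2 / \<epsilon>\<^sup>2 * r n = C / n\<close> for positive
    \<open>n\<close>.\<close>
  define r where "r = (\<lambda>n :: nat. \<epsilon>\<^sup>2 / 2 * C / real n)"
  have "r \<longlonglongrightarrow> 0" unfolding r_def by (rule lim_const_over_n)
  moreover have "worst_risk ({0..1} \<times> {0..1}) (cov_est \<epsilon>) cov n0 \<le> ennreal (2 / \<epsilon>\<^sup>2 * (1 + r n0))"
    if "n0 \<ge> 1" for n0
    unfolding worst_risk_def
  proof (rule SUP_least)
    fix D :: "(real \<times> real) list"
    assume D: "D \<in> {D \<in> lists ({0..1} \<times> {0..1}). n0 \<le> length D}"
    then have "risk (cov_est \<epsilon>) cov D \<le> ennreal (2 / \<epsilon>\<^sup>2 + C / real (length D))"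
      unfolding C_def K_def using that assms by (intro risk_cov_est_le) auto
    also have "\<dots> \<le> ennreal (2 / \<epsilon>\<^sup>2 + C / real n0)"
      using D C that by (intro ennreal_leI add_left_mono frac_le) auto
    also have "2 / \<epsilon>\<^sup>2 + C / real n0 = 2 / \<epsilon>\<^sup>2 * (1 + r n0)"
      using assms that by (simp add: r_def field_simps)
    finally show "risk (cov_est \<epsilon>) cov D \<le> ennreal (2 / \<epsilon>\<^sup>2 * (1 + r n0))" .
  qed
  ultimately show ?thesis by blast
qed

end
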